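(* Assume the standing setup below. Then each of the induced subposets $A\setminus X$ and $C\setminus X$ of $Q$ is of one of the following forms: (i) an antichain, possibly together with a single additional element below all elements of the antichain and/or a single additional element above all elements of the antichain; or (ii) the three-element poset consisting of a two-element chain and one element incomparable to both.
   Context: Standing setup: $\Gamma_n=\{A,B,C\}$ is a set of three pairwise non-isomorphic posets of size $n$, and $Q$ is a witness of $\Gamma_n$ (the set of isomorphism classes of downsets of $Q$ of size $n$ is exactly $\Gamma_n$). $G_n(Q)$ is the exchange graph: vertices are all downsets of $Q$ of size $n$ (as subsets), adjacent when they differ by exactly one element. A special path is a path $v_0,\ldots,v_r$ ($r\ge2$) in $G_n(Q)$ whose first vertex, internal vertices, and last vertex are isomorphic to three distinct members of $\Gamma_n$ respectively (all internal vertices isomorphic to the same member). Fix a special path of minimal length among all special paths in $G_n(Q)$, labelled so that $v_0\cong A$, $v_1,\ldots,v_{r-1}\cong B$, $v_r\cong C$; $A:=v_0$, $C:=v_r$ denote these specific downsets. Assume $Q$ equals the union of the vertices of this path. Let $X=A\cap C$ and $m=|A\setminus X|=|C\setminus X|$. *)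

theory Defs
  imports Main
begin

definition partial_order_on' :: "'a set \<Rightarrow> ('a \<Rightarrow> 'a \<Rightarrow> bool) \<Rightarrow> bool" where
  "partial_order_on' S le \<longleftrightarrow>
     (\<forall>x\<in>S. le x x) \<and>
     (\<forall>x\<in>S. \<forall>y\<in>S. le x y \<and> le y x \<longrightarrow> x = y) \<and>
     (\<forall>x\<in>S. \<forall>y\<in>S. \<forall>z\<in>S. le x y \<and> le y z \<longrightarrow> le x z)"

definition poset_iso :: "'a set \<Rightarrow> ('a \<Rightarrow> 'a \<Rightarrow> bool) \<Rightarrow> 'b set \<Rightarrow> ('b \<Rightarrow> 'b \<Rightarrow> bool) \<Rightarrow> bool" where
  "poset_iso S r T s \<longleftrightarrow>
     (\<exists>f. bij_betw f S T \<and> (\<forall>x\<in>S. \<forall>y\<in>S. r x y \<longleftrightarrow> s (f x) (f y)))"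

definition downset :: "'a set \<Rightarrow> ('a \<Rightarrow> 'a \<Rightarrow> bool) \<Rightarrow> 'a set \<Rightarrow> bool" where
  "downset Q le D \<longleftrightarrow> D \<subseteq> Q \<and> (\<forall>x\<in>D. \<forall>y\<in>Q. le y x \<longrightarrow> y \<in> D)"

definition ndownset :: "'a set \<Rightarrow> ('a \<Rightarrow> 'a \<Rightarrow> bool) \<Rightarrow> nat \<Rightarrow> 'a set \<Rightarrow> bool" where
  "ndownset Q le n D \<longleftrightarrow> downset Q le D \<and> finite D \<and> card D = n"

definition exch_adj :: "'a set \<Rightarrow> 'a set \<Rightarrow> bool" where
  "exch_adj D1 D2 \<longleftrightarrow> card (D1 - D2) = 1 \<and> card (D2 - D1) = 1"

definition witness :: "'a set \<Rightarrow> ('a \<Rightarrow> 'a \<Rightarrow> bool) \<Rightarrow> nat \<Rightarrow> ('b set \<times> ('b \<Rightarrow> 'b \<Rightarrow> bool)) set \<Rightarrow> bool" where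
  "witness Q le n G \<longleftrightarrow>
     (\<forall>D. ndownset Q le n D \<longrightarrow> (\<exists>P\<in>G. poset_iso D le (fst P) (snd P))) \<and>
     (\<forall>P\<in>G. \<exists>D. ndownset Q le n D \<and> poset_iso D le (fst P) (snd P))"

definition exch_path :: "'a set \<Rightarrow> ('a \<Rightarrow> 'a \<Rightarrow> bool) \<Rightarrow> nat \<Rightarrow> 'a set list \<Rightarrow> bool" where
  "exch_path Q le n vs \<longleftrightarrow>
     vs \<noteq> [] \<and> distinct vs \<and> (\<forall>v\<in>set vs. ndownset Q le n v) \<and>
     (\<forall>i. Suc i < length vs \<longrightarrow> exch_adj (vs ! i) (vs ! Suc i))"

definition special_path :: "'a set \<Rightarrow> ('a \<Rightarrow> 'a \<Rightarrow> bool) \<Rightarrow> nat \<Rightarrow> ('b set \<times> ('b \<Rightarrow> 'b \<Rightarrow> bool)) set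
    \<Rightarrow> 'a set list \<Rightarrow> bool" where
  "special_path Q le n G vs \<longleftrightarrow>
     exch_path Q le n vs \<and> length vs \<ge> 3 \<and>
     (\<exists>P1\<in>G. \<exists>P2\<in>G. \<exists>P3\<in>G. P1 \<noteq> P2 \<and> P1 \<noteq> P3 \<and> P2 \<noteq> P3 \<and>
        poset_iso (hd vs) le (fst P1) (snd P1) \<and>
        (\<forall>i. 0 < i \<and> i < length vs - 1 \<longrightarrow> poset_iso (vs ! i) le (fst P2) (snd P2)) \<and>
        poset_iso (last vs) le (fst P3) (snd P3))"

definition lt_of :: "('a \<Rightarrow> 'a \<Rightarrow> bool) \<Rightarrow> 'a \<Rightarrow> 'a \<Rightarrow> bool" where
  "lt_of le x y \<longleftrightarrow> le x y \<and> x \<noteq> y"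

definition incomparable :: "('a \<Rightarrow> 'a \<Rightarrow> bool) \<Rightarrow> 'a \<Rightarrow> 'a \<Rightarrow> bool" where
  "incomparable le x y \<longleftrightarrow> \<not> le x y \<and> \<not> le y x"

definition antichain_with_ends :: "('a \<Rightarrow> 'a \<Rightarrow> bool) \<Rightarrow> 'a set \<Rightarrow> bool" where
  "antichain_with_ends le T \<longleftrightarrow>
     (\<exists>U Bot Top. T = U \<union> Bot \<union> Top \<and>
        U \<inter> Bot = {} \<and> U \<inter> Top = {} \<and> Bot \<inter> Top = {} \<and>
        finite Bot \<and> card Bot \<le> 1 \<and> finite Top \<and> card Top \<le> 1 \<and>
        (\<forall>x\<in>U. \<forall>y\<in>U. x \<noteq> y \<longrightarrow> incomparable le x y) \<and>
        (\<forall>b\<in>Bot. \<forall>u\<in>U. lt_of le b u) \<and>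
        (\<forall>t\<in>Top. \<forall>u\<in>U. lt_of le u t))"

definition chain2_plus_point :: "('a \<Rightarrow> 'a \<Rightarrow> bool) \<Rightarrow> 'a set \<Rightarrow> bool" where
  "chain2_plus_point le T \<longleftrightarrow>
     (\<exists>x y z. T = {x, y, z} \<and> x \<noteq> z \<and> y \<noteq> z \<and> lt_of le x y \<and>
        incomparable le x z \<and> incomparable le y z)"

end

theory Submission
  imports Defs
begin

text \<open>
  Write \<open>A\<close>, \<open>C\<close> for the end vertices of the path and \<open>m = |A - X|\<close>. For \<open>m \<le> 2\<close> there is
  nothing to prove, so let \<open>m \<ge> 3\<close>, and call an \<open>n\<close>-downset \<open>Z\<close> with \<open>X \<subseteq> Z \<subseteq> A \<union> C\<close>,
  \<open>Z \<noteq> A, C\<close> intermediate.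

  Minimality of the special path forbids every shorter path of the exchange graph to visit
  three pairwise non-isomorphic downsets. Applied to geodesics, which stay inside the interval
  between their end points, and to paths of length two, this forces every intermediate
  downset to be isomorphic to \<open>B\<close>.

  The number of strictly comparable pairs of a downset \<open>Z\<close> of \<open>Q\<close> is the sum over \<open>z \<in> Z\<close> of
  the number of elements strictly below \<open>z\<close> in \<open>Q\<close>, the degree of \<open>z\<close>. So this degree sum is
  the same for all intermediate \<open>Z\<close>. Splitting an intermediate downset as \<open>W \<union> V\<close> with
  \<open>X \<subseteq> W \<subseteq> A\<close>, \<open>X \<subseteq> V \<subseteq> C\<close> shows that the degree of an element removable from such a \<open>W\<close>
  depends only on \<open>|W - X|\<close> (in the range \<open>2..m-1\<close>), and that it is nondecreasing and, by
  the same argument on the side of \<open>C\<close>, nonincreasing in \<open>|W - X|\<close>. Every element of \<open>A - X\<close>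
  that is neither least nor greatest is removable in this range, so all these elements have
  the same degree; as the degree is strictly monotone, they form an antichain.
\<close>

section \<open>Finite posets\<close>

lemma partial_order_on'_refl: "partial_order_on' Q le \<Longrightarrow> x \<in> Q \<Longrightarrow> le x x"
  unfolding partial_order_on'_def by blast

lemma partial_order_on'_antisym:
  "partial_order_on' Q le \<Longrightarrow> x \<in> Q \<Longrightarrow> y \<in> Q \<Longrightarrow> le x y \<Longrightarrow> le y x \<Longrightarrow> x = y"
  unfolding partial_order_on'_def by blast

lemma partial_order_on'_trans:
  "partial_order_on' Q le \<Longrightarrow> x \<in> Q \<Longrightarrow> y \<in> Q \<Longrightarrow> z \<in> Q \<Longrightarrow> le x y \<Longrightarrow> le y z \<Longrightarrow> le x z"
  unfolding partial_order_on'_def by blast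

lemma partial_order_on'_converse:
  "partial_order_on' Q le \<Longrightarrow> partial_order_on' Q (\<lambda>x y. le y x)"
  unfolding partial_order_on'_def by blast

lemma finite_has_maximal_on:
  assumes po: "partial_order_on' Q le" and "finite S" "S \<noteq> {}" "S \<subseteq> Q"
  shows "\<exists>x\<in>S. \<forall>y\<in>S. le x y \<longrightarrow> y = x"
  using assms(2-4)
proof (induction S rule: finite_ne_induct)
  case (singleton a)
  then show ?case by auto
next
  case (insert a F)
  then obtain x where x: "x \<in> F" "\<forall>y\<in>F. le x y \<longrightarrow> y = x" by auto
  show ?case
  proof (cases "le x a")
    case True
    have "y = a" if "y \<in> F" "le a y" for y
    proof -
      have "le x y" using partial_order_on'_trans[OF po] True that insert x by blast
      then show ?thesis using x that partial_order_on'_antisym[OF po, of a x] True insert by auto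
    qed
    then show ?thesis by auto
  next
    case False
    then show ?thesis using x by auto
  qed
qed

lemma finite_has_minimal_on:
  assumes "partial_order_on' Q le" "finite S" "S \<noteq> {}" "S \<subseteq> Q"
  shows "\<exists>x\<in>S. \<forall>y\<in>S. le y x \<longrightarrow> y = x"
  using finite_has_maximal_on[OF partial_order_on'_converse[OF assms(1)] assms(2-4)] .

lemma poset_iso_refl: "poset_iso S r S r"
  unfolding poset_iso_def by (rule exI[of _ id]) auto

lemma poset_iso_sym:
  assumes "poset_iso S r T s" shows "poset_iso T s S r"
proof -
  obtain f where f: "bij_betw f S T" "\<forall>x\<in>S. \<forall>y\<in>S. r x y = s (f x) (f y)"
    using assms unfolding poset_iso_def by blast
  have g: "bij_betw (inv_into S f) T S"
    using f(1) by (rule bij_betw_inv_into)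
  have "s x y = r (inv_into S f x) (inv_into S f y)" if "x \<in> T" "y \<in> T" for x y
    using f that g bij_betw_inv_into_right[OF f(1)] by (metis bij_betwE)
  then show ?thesis
    unfolding poset_iso_def using g by blast
qed

lemma poset_iso_trans:
  assumes "poset_iso S r T s" "poset_iso T s U t" shows "poset_iso S r U t"
proof -
  obtain f where f: "bij_betw f S T" "\<forall>x\<in>S. \<forall>y\<in>S. r x y = s (f x) (f y)"
    using assms(1) unfolding poset_iso_def by blast
  obtain g where g: "bij_betw g T U" "\<forall>x\<in>T. \<forall>y\<in>T. s x y = t (g x) (g y)"
    using assms(2) unfolding poset_iso_def by blast
  have "\<forall>x\<in>S. \<forall>y\<in>S. r x y = t ((g \<circ> f) x) ((g \<circ> f) y)"
    using f g by (auto simp: bij_betw_def)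
  then show ?thesis
    unfolding poset_iso_def using bij_betw_trans[OF f(1) g(1)] by blast
qed

definition strict_pairs :: "'c set \<Rightarrow> ('c \<Rightarrow> 'c \<Rightarrow> bool) \<Rightarrow> nat" where
  "strict_pairs S r = card (SIGMA y:S. {x\<in>S. r x y \<and> x \<noteq> y})"

definition down_degree :: "'a set \<Rightarrow> ('a \<Rightarrow> 'a \<Rightarrow> bool) \<Rightarrow> 'a \<Rightarrow> nat" where
  "down_degree Q le y = card {x\<in>Q. le x y \<and> x \<noteq> y}"

lemma strict_pairs_iso:
  assumes "poset_iso S r T s" shows "strict_pairs S r = strict_pairs T s"
proof -
  obtain f where f: "bij_betw f S T" "\<forall>x\<in>S. \<forall>y\<in>S. r x y = s (f x) (f y)"
    using assms unfolding poset_iso_def by blast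
  have "bij_betw (map_prod f f) (SIGMA y:S. {x\<in>S. r x y \<and> x \<noteq> y})
          (SIGMA y:T. {x\<in>T. s x y \<and> x \<noteq> y})"
    using f unfolding bij_betw_def inj_on_def by (auto simp: image_iff)
  then show ?thesis
    unfolding strict_pairs_def by (rule bij_betw_same_card)
qed

lemma strict_pairs_downset:
  assumes "downset Q le Z" "finite Q"
  shows "strict_pairs Z le = (\<Sum>y\<in>Z. down_degree Q le y)"
proof -
  have "(SIGMA y:Z. {x\<in>Z. le x y \<and> x \<noteq> y}) = (SIGMA y:Z. {x\<in>Q. le x y \<and> x \<noteq> y})"
    using assms(1) unfolding downset_def by auto
  moreover have "finite Z"
    using assms finite_subset unfolding downset_def by blast
  ultimately show ?thesis
    unfolding strict_pairs_def down_degree_def using assms(2) by simp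
qed

lemma down_degree_strict_mono:
  assumes po: "partial_order_on' Q le" and "finite Q" "x \<in> Q" "y \<in> Q" "le x y" "x \<noteq> y"
  shows "down_degree Q le x < down_degree Q le y"
proof -
  have "{z\<in>Q. le z x \<and> z \<noteq> x} \<subset> {z\<in>Q. le z y \<and> z \<noteq> y}"
    using assms partial_order_on'_trans[OF po] partial_order_on'_antisym[OF po] by blast
  then show ?thesis
    unfolding down_degree_def using \<open>finite Q\<close> by (simp add: psubset_card_mono)
qed

section \<open>Downsets\<close>

lemma downsetD: "downset Q le D \<Longrightarrow> w \<in> D \<Longrightarrow> u \<in> Q \<Longrightarrow> le u w \<Longrightarrow> u \<in> D"
  unfolding downset_def by blast

lemma downset_subset: "downset Q le D \<Longrightarrow> D \<subseteq> Q"
  unfolding downset_def by blast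

lemma downset_empty: "downset Q le {}"
  unfolding downset_def by blast

lemma downset_Int: "downset Q le A \<Longrightarrow> downset Q le B \<Longrightarrow> downset Q le (A \<inter> B)"
  unfolding downset_def by blast

lemma downset_Un: "downset Q le A \<Longrightarrow> downset Q le B \<Longrightarrow> downset Q le (A \<union> B)"
  unfolding downset_def by blast

lemma downset_remove_maximal:
  assumes "downset Q le D" "downset Q le T" "x \<in> D - T" "\<forall>z\<in>D - T. le x z \<longrightarrow> z = x"
  shows "downset Q le (D - {x})"
  unfolding downset_def
proof (intro conjI ballI impI)
  show "D - {x} \<subseteq> Q" using assms(1) downset_subset by blast
next
  fix w u assume w: "w \<in> D - {x}" and u: "u \<in> Q" "le u w"
  have "u \<in> D" using downsetD[OF assms(1) _ u] w by blast
  moreover have "u \<noteq> x"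
    using assms(3,4) w u(2) downsetD[OF assms(2) _ u(1)] by (cases "w \<in> T") auto
  ultimately show "u \<in> D - {x}" by blast
qed

lemma downset_insert_minimal:
  assumes "downset Q le L" "downset Q le T" "y \<in> T" "\<forall>z\<in>T - L. le z y \<longrightarrow> z = y"
  shows "downset Q le (insert y L)"
  unfolding downset_def
proof (intro conjI ballI impI)
  show "insert y L \<subseteq> Q" using assms(1-3) downset_subset by blast
next
  fix w u assume w: "w \<in> insert y L" and u: "u \<in> Q" "le u w"
  show "u \<in> insert y L"
  proof (cases "w = y")
    case True
    then show ?thesis using assms(3,4) downsetD[OF assms(2) _ u] u(2) by blast
  next
    case False
    then show ?thesis using w downsetD[OF assms(1) _ u] by blast
  qed
qed

lemma downset_interpolate:
  assumes po: "partial_order_on' Q le" and "downset Q le L" "downset Q le U" "L \<subseteq> U" "finite U"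
    and "card L \<le> k" "k \<le> card U"
  shows "\<exists>W. downset Q le W \<and> L \<subseteq> W \<and> W \<subseteq> U \<and> card W = k"
  using assms(6,7)
proof (induction k rule: dec_induct)
  case base
  then show ?case using assms(2,4) by blast
next
  case (step k)
  then obtain W where W: "downset Q le W" "L \<subseteq> W" "W \<subseteq> U" "card W = k"
    by auto
  have "finite W" using W(3) \<open>finite U\<close> finite_subset by blast
  have "U - W \<noteq> {}"
    using W(3,4) step.prems card_mono[OF \<open>finite W\<close>, of U] by auto
  then obtain y where y: "y \<in> U - W" "\<forall>z\<in>U - W. le z y \<longrightarrow> z = y"
    using finite_has_minimal_on[OF po, of "U - W"] assms(3,5) downset_subset by blast
  have "downset Q le (insert y W)"
    using downset_insert_minimal[OF W(1) assms(3)] y by blast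
  moreover have "card (insert y W) = Suc k"
    using W(4) y(1) \<open>finite W\<close> by simp
  ultimately show ?case using W y by blast
qed

lemma downset_exchange:
  assumes po: "partial_order_on' Q le" and "downset Q le D" "downset Q le T"
    and "finite D" "finite T" "card D = card T" "D \<noteq> T"
  shows "\<exists>x y. x \<in> D - T \<and> y \<in> T - D \<and> downset Q le (insert y (D - {x}))"
proof -
  have fin: "finite (D - T)" "finite (T - D)" and sub: "D - T \<subseteq> Q" "T - D \<subseteq> Q"
    using assms(2-5) downset_subset by auto
  have "D - T \<noteq> {}" "T - D \<noteq> {}"
    using card_subset_eq[OF assms(5) _ assms(6)] card_subset_eq[OF assms(4) _ assms(6)[symmetric]]
      assms(7) by auto
  then obtain x y where x: "x \<in> D - T" "\<forall>z\<in>D - T. le x z \<longrightarrow> z = x"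
    and y: "y \<in> T - D" "\<forall>z\<in>T - D. le z y \<longrightarrow> z = y"
    using finite_has_maximal_on[OF po fin(1) _ sub(1)] finite_has_minimal_on[OF po fin(2) _ sub(2)]
    by blast
  have "downset Q le (D - {x})"
    using downset_remove_maximal[OF assms(2,3) x] .
  moreover have "T - (D - {x}) = T - D"
    using x(1) by blast
  ultimately have "downset Q le (insert y (D - {x}))"
    using downset_insert_minimal[OF _ assms(3)] y by simp
  then show ?thesis using x y by blast
qed

lemma downset_atMost:
  assumes "partial_order_on' Q le" "u \<in> Q"
  shows "downset Q le {y\<in>Q. le y u}"
  unfolding downset_def
proof (intro conjI ballI impI)
  fix w v assume "w \<in> {y\<in>Q. le y u}" "v \<in> Q" "le v w"
  then show "v \<in> {y\<in>Q. le y u}"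
    using partial_order_on'_trans[OF assms(1) _ _ assms(2)] by auto
qed auto

lemma downset_not_above:
  assumes po: "partial_order_on' Q le" and "u \<in> Q"
  shows "downset Q le {y\<in>Q. \<not> (le u y \<and> y \<noteq> u)}"
  unfolding downset_def
proof (intro conjI ballI impI)
  fix w v assume w: "w \<in> {y\<in>Q. \<not> (le u y \<and> y \<noteq> u)}" and v: "v \<in> Q" "le v w"
  show "v \<in> {y\<in>Q. \<not> (le u y \<and> y \<noteq> u)}"
  proof (cases "w = u")
    case True
    then show ?thesis
      using v partial_order_on'_antisym[OF po] \<open>u \<in> Q\<close> by auto
  next
    case False
    then show ?thesis
      using v w partial_order_on'_trans[OF po, of u v w] \<open>u \<in> Q\<close> by auto
  qed
qed auto

definition minimal_over :: "'a set \<Rightarrow> ('a \<Rightarrow> 'a \<Rightarrow> bool) \<Rightarrow> 'a set \<Rightarrow> 'a \<Rightarrow> bool" where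
  "minimal_over Q le X p \<longleftrightarrow> (\<forall>u\<in>Q. le u p \<longrightarrow> u = p \<or> u \<in> X)"

lemma downset_Un_minimal_over:
  assumes "downset Q le X" "S \<subseteq> Q" "\<forall>s\<in>S. minimal_over Q le X s"
  shows "downset Q le (X \<union> S)"
  using assms unfolding downset_def minimal_over_def by blast

lemma ex_minimal_over:
  assumes po: "partial_order_on' Q le" and "downset Q le A" "downset Q le C" "downset Q le V"
    and "V \<subseteq> A \<union> C" "finite V" "V - C \<noteq> {}"
  shows "\<exists>p\<in>V - C. minimal_over Q le (A \<inter> C) p"
proof -
  obtain p where p: "p \<in> V - C" "\<forall>z\<in>V - C. le z p \<longrightarrow> z = p"
    using finite_has_minimal_on[OF po, of "V - C"] assms(4,6,7) downset_subset by blast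
  have "u = p \<or> u \<in> A \<inter> C" if "u \<in> Q" "le u p" for u
  proof -
    have "u \<in> V" "u \<in> A"
      using downsetD[OF assms(4) _ that] downsetD[OF assms(2) _ that] p assms(5) by auto
    then show ?thesis using p that by blast
  qed
  then show ?thesis
    unfolding minimal_over_def using p(1) by blast
qed

section \<open>The exchange graph\<close>

lemma ndownset_swap:
  assumes "ndownset Q le n D" "x \<in> D" "y \<notin> D" "downset Q le (insert y (D - {x}))"
  shows "ndownset Q le n (insert y (D - {x}))"
  using assms card_Suc_Diff1[of D x] unfolding ndownset_def by auto

lemma ndownset_Diff_ne:
  assumes "ndownset Q le n D" "ndownset Q le n E" "D \<noteq> E"
  shows "D - E \<noteq> {}"
proof
  assume "D - E = {}"
  then have "D \<subseteq> E" by blast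
  then show False
    using assms card_subset_eq[of E D] unfolding ndownset_def by simp
qed

lemma exch_adj_sym: "exch_adj D E \<Longrightarrow> exch_adj E D"
  unfolding exch_adj_def by simp

lemma exch_adj_swap:
  assumes "x \<in> D" "y \<notin> D"
  shows "exch_adj D (insert y (D - {x}))"
proof -
  have "D - insert y (D - {x}) = {x}" "insert y (D - {x}) - D = {y}"
    using assms by auto
  then show ?thesis unfolding exch_adj_def by simp
qed

lemma exch_adjE:
  assumes "exch_adj D E"
  obtains x y where "D - E = {x}" "E - D = {y}"
  using assms unfolding exch_adj_def by (metis One_nat_def card_1_singleton_iff)

lemma exch_adj_square:
  assumes po: "partial_order_on' Q le"
    and Z: "ndownset Q le n Z" and W: "ndownset Q le n W" and C: "ndownset Q le n C"
    and f: "Z - W = {f}" and e: "W - Z = {e}" and "e \<in> C \<longleftrightarrow> f \<in> C" and "W \<noteq> C"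
  obtains Y where "ndownset Q le n Y" "Z \<inter> C \<subseteq> Y" "Y \<subseteq> Z \<union> C" "W \<inter> C \<subseteq> Y" "Y \<subseteq> W \<union> C"
    "exch_adj Z Y" "exch_adj Y W"
proof -
  have dZ: "downset Q le Z" and dW: "downset Q le W" and dC: "downset Q le C"
    and finW: "finite W" and finC: "finite C"
    using Z W C unfolding ndownset_def by auto
  have ef: "f \<in> Z" "f \<notin> W" "e \<in> W" "e \<notin> Z" and W_eq: "W = insert e (Z - {f})"
    using e f by blast+
  show thesis
  proof (cases "e \<in> C")
    case False
    then have "f \<notin> C" using assms(7) by simp
    obtain g where g: "g \<in> C - W" "\<forall>z\<in>C - W. le z g \<longrightarrow> z = g"
      using finite_has_minimal_on[OF po, of "C - W"] ndownset_Diff_ne[OF C W] \<open>W \<noteq> C\<close> finC dC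
        downset_subset by blast
    have "W - {e} = W \<inter> Z" "C - (W - {e}) = C - W"
      using W_eq ef False by auto
    then have "downset Q le (insert g (W - {e}))"
      using downset_insert_minimal[OF downset_Int[OF dW dZ] dC] g by auto
    then have "ndownset Q le n (insert g (W - {e}))"
      using ndownset_swap[OF W] ef g by blast
    moreover have "insert g (W - {e}) = insert g (Z - {f})" "g \<notin> Z"
      using W_eq ef g \<open>f \<notin> C\<close> by auto
    ultimately show thesis
      using that[of "insert g (W - {e})"] exch_adj_swap[of f Z g] exch_adj_swap[of e W g]
        exch_adj_sym W_eq ef g False \<open>f \<notin> C\<close> by auto
  next
    case True
    then have "f \<in> C" using assms(7) by simp
    obtain h where h: "h \<in> W - C" "\<forall>z\<in>W - C. le h z \<longrightarrow> z = h"
      using finite_has_maximal_on[OF po, of "W - C"] ndownset_Diff_ne[OF W C] \<open>W \<noteq> C\<close> finW dW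
        downset_subset by blast
    have "\<forall>z\<in>(Z \<inter> C) - (W - {h}). le z f \<longrightarrow> z = f"
      using W_eq ef h by auto
    then have "downset Q le (insert f (W - {h}))"
      using downset_insert_minimal[OF downset_remove_maximal[OF dW dC h] downset_Int[OF dZ dC]]
        ef \<open>f \<in> C\<close> by blast
    then have "ndownset Q le n (insert f (W - {h}))"
      using ndownset_swap[OF W] h ef by blast
    moreover have "insert f (W - {h}) = insert e (Z - {h})" "h \<in> Z"
      using W_eq ef h True by auto
    ultimately show thesis
      using that[of "insert f (W - {h})"] exch_adj_swap[of h Z e] exch_adj_swap[of h W f]
        exch_adj_sym W_eq ef h True \<open>f \<in> C\<close> by auto
  qed
qed

lemma exch_path_nth:
  "exch_path Q le n ws \<Longrightarrow> k < length ws \<Longrightarrow> ndownset Q le n (ws ! k)"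
  unfolding exch_path_def by simp

lemma exch_path_adj:
  "exch_path Q le n ws \<Longrightarrow> Suc k < length ws \<Longrightarrow> exch_adj (ws ! k) (ws ! Suc k)"
  unfolding exch_path_def by blast

lemma exch_path_Cons:
  assumes "exch_path Q le n ws" "ndownset Q le n D" "D \<notin> set ws" "exch_adj D (hd ws)"
  shows "exch_path Q le n (D # ws)"
  using assms unfolding exch_path_def by (auto simp: nth_Cons hd_conv_nth split: nat.split)

lemma exch_path_rev:
  assumes "exch_path Q le n ws" shows "exch_path Q le n (rev ws)"
  unfolding exch_path_def
proof (intro conjI allI impI)
  fix i assume i: "Suc i < length (rev ws)"
  have "exch_adj (ws ! (length ws - Suc (Suc i))) (ws ! Suc (length ws - Suc (Suc i)))"
    using assms i unfolding exch_path_def by simp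
  moreover have "Suc (length ws - Suc (Suc i)) = length ws - Suc i"
    using i by simp
  ultimately show "exch_adj (rev ws ! i) (rev ws ! Suc i)"
    using i by (simp add: rev_nth exch_adj_sym)
qed (use assms in \<open>auto simp: exch_path_def\<close>)

lemma exch_path_segment:
  assumes "exch_path Q le n ws" "i \<le> l" "l < length ws"
  shows "exch_path Q le n (take (Suc (l - i)) (drop i ws))"
  unfolding exch_path_def
proof (intro conjI allI impI ballI)
  fix k assume "Suc k < length (take (Suc (l - i)) (drop i ws))"
  then show "exch_adj (take (Suc (l - i)) (drop i ws) ! k) (take (Suc (l - i)) (drop i ws) ! Suc k)"
    using exch_path_adj[OF assms(1), of "i + k"] assms(2,3) by simp
qed (use assms in \<open>auto simp: exch_path_def dest: in_set_takeD in_set_dropD\<close>)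

lemma exch_path_card_Diff:
  assumes "exch_path Q le n ws" "i \<le> j" "j < length ws"
  shows "card (ws ! i - ws ! j) \<le> j - i"
  using assms(2,3)
proof (induction j rule: dec_induct)
  case base
  then show ?case by simp
next
  case (step j)
  have "finite (ws ! i)" "finite (ws ! j)"
    using exch_path_nth[OF assms(1)] step unfolding ndownset_def by simp_all
  then have "card (ws ! i - ws ! Suc j) \<le> card ((ws ! i - ws ! j) \<union> (ws ! j - ws ! Suc j))"
    by (intro card_mono) auto
  also have "\<dots> \<le> card (ws ! i - ws ! j) + card (ws ! j - ws ! Suc j)"
    by (rule card_Un_le)
  also have "card (ws ! j - ws ! Suc j) = 1"
    using exch_path_adj[OF assms(1) step.prems] unfolding exch_adj_def by simp
  finally show ?case using step by simp
qed

lemma ndownset_step_towards: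
  assumes po: "partial_order_on' Q le" and D: "ndownset Q le n D"
    and T: "ndownset Q le n T" "T \<noteq> D" "D \<inter> E \<subseteq> T" "T \<subseteq> D \<union> E"
  obtains x y where "x \<in> D - E" "x \<notin> T" "y \<in> E - D" "y \<in> T" "ndownset Q le n (insert y (D - {x}))"
proof -
  have "downset Q le D" "downset Q le T" "finite D" "finite T" "card D = card T"
    using D T(1) unfolding ndownset_def by auto
  then obtain x y where "x \<in> D - T" "y \<in> T - D" "downset Q le (insert y (D - {x}))"
    using downset_exchange[OF po] T(2) by metis
  then show thesis
    using that ndownset_swap[OF D] T(3,4) by blast
qed

lemma exch_path_geodesic:
  assumes po: "partial_order_on' Q le"
    and "ndownset Q le n D" "ndownset Q le n E" "ndownset Q le n Z" "D \<inter> E \<subseteq> Z" "Z \<subseteq> D \<union> E"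
  shows "\<exists>ws. exch_path Q le n ws \<and> hd ws = D \<and> last ws = E \<and> Z \<in> set ws \<and>
    length ws = Suc (card (D - E)) \<and> (\<forall>W\<in>set ws. D \<inter> E \<subseteq> W \<and> W \<subseteq> D \<union> E)"
proof -
  obtain k where "card (D - E) = k" by simp
  then show ?thesis
    using assms(2-6)
  proof (induction k arbitrary: D Z)
    case 0
    then have "D \<subseteq> E" "finite E" "card D = card E"
      unfolding ndownset_def by auto
    then have "D = E" by (simp add: card_subset_eq)
    then have "Z = D" using "0.prems" by blast
    then show ?case
      using "0.prems" \<open>D = E\<close> by (intro exI[of _ "[D]"]) (auto simp: exch_path_def)
  next
    case (Suc k)
    have "D \<noteq> E" using Suc.prems(1) by auto
    define T where "T = (if Z = D then E else Z)"
    have "ndownset Q le n T" "T \<noteq> D" "D \<inter> E \<subseteq> T" "T \<subseteq> D \<union> E"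
      using Suc.prems \<open>D \<noteq> E\<close> unfolding T_def by auto
    then obtain x y where x: "x \<in> D - E" "x \<notin> T" and y: "y \<in> E - D" "y \<in> T"
      and ndD': "ndownset Q le n (insert y (D - {x}))"
      by (rule ndownset_step_towards[OF po Suc.prems(2)])
    define D' where "D' = insert y (D - {x})"
    have "D' - E = (D - E) - {x}"
      unfolding D'_def using y by blast
    then have "card (D' - E) = k"
      using Suc.prems(1) x by (simp add: card_Diff_singleton)
    define Z' where "Z' = (if Z = D then D' else Z)"
    have ndZ': "ndownset Q le n Z'"
      using ndD' Suc.prems(4) unfolding Z'_def D'_def by simp
    have Z': "D' \<inter> E \<subseteq> Z' \<and> Z' \<subseteq> D' \<union> E"
      using x y Suc.prems(5,6) unfolding Z'_def D'_def T_def by (cases "Z = D") auto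
    obtain ws where ws: "exch_path Q le n ws" "hd ws = D'" "last ws = E" "Z' \<in> set ws"
      "length ws = Suc k" "\<forall>W\<in>set ws. D' \<inter> E \<subseteq> W \<and> W \<subseteq> D' \<union> E"
      using Suc.IH[OF \<open>card (D' - E) = k\<close> ndD'[folded D'_def] Suc.prems(3) ndZ' conjunct1[OF Z']
        conjunct2[OF Z']]
      by (elim exE conjE) (rule that, simp_all add: \<open>card (D' - E) = k\<close>)
    have "\<not> D \<subseteq> D' \<union> E"
      using x y unfolding D'_def by auto
    then have "D \<notin> set ws"
      using ws(6) by metis
    moreover have "exch_adj D (hd ws)"
      unfolding ws(2) D'_def using x y by (simp add: exch_adj_swap)
    ultimately have "exch_path Q le n (D # ws)"
      using exch_path_Cons[OF ws(1) Suc.prems(2)] by blast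
    moreover have "Z \<in> set (D # ws)"
      using ws(4) unfolding Z'_def by (cases "Z = D") auto
    moreover have "D \<inter> E \<subseteq> D' \<inter> E" "D' \<union> E \<subseteq> D \<union> E"
      using x y unfolding D'_def by blast+
    then have "\<forall>W\<in>set (D # ws). D \<inter> E \<subseteq> W \<and> W \<subseteq> D \<union> E"
      using ws(6) by (metis Un_upper1 inf_le1 set_ConsD subset_trans)
    moreover have "hd (D # ws) = D" "last (D # ws) = E" "length (D # ws) = Suc (card (D - E))"
      using ws(3,5) Suc.prems(1) by auto
    ultimately show ?case by blast
  qed
qed

lemma special_path_rev:
  assumes "special_path Q le n G vs" shows "special_path Q le n G (rev vs)"
proof -
  obtain P1 P2 P3 where P: "P1 \<in> G" "P2 \<in> G" "P3 \<in> G" "P1 \<noteq> P2" "P1 \<noteq> P3" "P2 \<noteq> P3"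
    "poset_iso (hd vs) le (fst P1) (snd P1)" "poset_iso (last vs) le (fst P3) (snd P3)"
    and inner: "\<forall>i. 0 < i \<and> i < length vs - 1 \<longrightarrow> poset_iso (vs ! i) le (fst P2) (snd P2)"
    using assms unfolding special_path_def by blast
  have "vs \<noteq> []" using assms unfolding special_path_def exch_path_def by blast
  have inner_rev: "poset_iso (rev vs ! i) le (fst P2) (snd P2)"
    if "0 < i" "i < length (rev vs) - 1" for i
  proof -
    have "Suc i < length vs" "length vs - Suc i < length vs - 1"
      using that by auto
    then show ?thesis
      using inner by (simp add: rev_nth)
  qed
  have ends: "hd (rev vs) = last vs" "last (rev vs) = hd vs"
    using \<open>vs \<noteq> []\<close> by (simp_all add: hd_rev last_rev)
  have "\<exists>P1\<in>G. \<exists>P2\<in>G. \<exists>P3\<in>G. P1 \<noteq> P2 \<and> P1 \<noteq> P3 \<and> P2 \<noteq> P3 \<and>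
      poset_iso (hd (rev vs)) le (fst P1) (snd P1) \<and>
      (\<forall>i. 0 < i \<and> i < length (rev vs) - 1 \<longrightarrow> poset_iso (rev vs ! i) le (fst P2) (snd P2)) \<and>
      poset_iso (last (rev vs)) le (fst P3) (snd P3)"
    by (rule bexI[of _ P3], rule bexI[of _ P2], rule bexI[of _ P1]) (use P inner_rev ends in auto)
  moreover have "exch_path Q le n (rev vs)" "3 \<le> length (rev vs)"
    using assms exch_path_rev unfolding special_path_def by auto
  ultimately show ?thesis
    unfolding special_path_def by (intro conjI) assumption+
qed

section \<open>Antichains with ends\<close>

definition non_extremal :: "('a \<Rightarrow> 'a \<Rightarrow> bool) \<Rightarrow> 'a set \<Rightarrow> 'a \<Rightarrow> bool" where
  "non_extremal le P u \<longleftrightarrow> (\<exists>y\<in>P. \<not> le u y) \<and> (\<exists>y\<in>P. \<not> le y u)"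

lemma antichain_with_endsI:
  assumes po: "partial_order_on' Q le" and "P \<subseteq> Q" "finite P"
    and inner: "\<And>u v. u \<in> P \<Longrightarrow> v \<in> P \<Longrightarrow> non_extremal le P u \<Longrightarrow> non_extremal le P v
      \<Longrightarrow> le u v \<Longrightarrow> u = v"
  shows "antichain_with_ends le P"
proof -
  define Bot where "Bot = {b\<in>P. \<forall>y\<in>P. le b y}"
  define Top where "Top = {t\<in>P. \<forall>y\<in>P. le y t} - Bot"
  define U where "U = P - Bot - Top"
  have "finite Bot" "finite Top"
    using \<open>finite P\<close> unfolding Bot_def Top_def by simp_all
  moreover have "\<forall>a\<in>Bot. \<forall>b\<in>Bot. a = b" "\<forall>a\<in>Top. \<forall>b\<in>Top. a = b"
    using \<open>P \<subseteq> Q\<close> partial_order_on'_antisym[OF po] unfolding Bot_def Top_def by blast+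
  ultimately have card: "card Bot \<le> 1" "card Top \<le> 1"
    by (simp_all add: card_le_Suc0_iff_eq)
  have "non_extremal le P x" if "x \<in> U" for x
    using that unfolding U_def Bot_def Top_def non_extremal_def by auto
  then have anti: "\<forall>x\<in>U. \<forall>y\<in>U. x \<noteq> y \<longrightarrow> incomparable le x y"
    using inner unfolding incomparable_def U_def by blast
  have ends: "\<forall>b\<in>Bot. \<forall>u\<in>U. lt_of le b u" "\<forall>t\<in>Top. \<forall>u\<in>U. lt_of le u t"
    unfolding lt_of_def U_def Bot_def Top_def by auto
  have parts: "P = U \<union> Bot \<union> Top" "U \<inter> Bot = {}" "U \<inter> Top = {}" "Bot \<inter> Top = {}"
    unfolding U_def Top_def Bot_def by auto
  show ?thesis
    unfolding antichain_with_ends_def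
    by (rule exI[of _ U], rule exI[of _ Bot], rule exI[of _ Top])
      (use card anti ends parts \<open>finite Bot\<close> \<open>finite Top\<close> in simp)
qed

lemma antichain_with_ends_card_le_2:
  assumes po: "partial_order_on' Q le" and "P \<subseteq> Q" "finite P" "card P \<le> 2"
  shows "antichain_with_ends le P"
proof (rule antichain_with_endsI[OF assms(1-3)])
  fix u v assume uv: "u \<in> P" "v \<in> P" "non_extremal le P u" "le u v"
  show "u = v"
  proof (rule ccontr)
    assume "u \<noteq> v"
    then have "P = {u, v}"
      using uv assms(3,4) card_subset_eq[of P "{u, v}"] card_mono[of P "{u, v}"] by auto
    then show False
      using uv partial_order_on'_refl[OF po] \<open>P \<subseteq> Q\<close> unfolding non_extremal_def by auto
  qed
qed

section \<open>Downsets with constant degree sum\<close>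

definition layer :: "'a set \<Rightarrow> ('a \<Rightarrow> 'a \<Rightarrow> bool) \<Rightarrow> 'a set \<Rightarrow> 'a set \<Rightarrow> nat \<Rightarrow> 'a set \<Rightarrow> bool" where
  "layer Q le X A s W \<longleftrightarrow> downset Q le W \<and> X \<subseteq> W \<and> W \<subseteq> A \<and> card W = card X + s"

definition removable :: "'a set \<Rightarrow> ('a \<Rightarrow> 'a \<Rightarrow> bool) \<Rightarrow> 'a set \<Rightarrow> 'a set \<Rightarrow> nat \<Rightarrow> 'a \<Rightarrow> bool" where
  "removable Q le X A s e \<longleftrightarrow> (\<exists>W. layer Q le X A s W \<and> e \<in> W - X \<and> downset Q le (W - {e}))"

locale constant_degree_sum =
  fixes Q :: "'a set" and le :: "'a \<Rightarrow> 'a \<Rightarrow> bool" and X A C :: "'a set" and \<kappa> :: nat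
  assumes po: "partial_order_on' Q le" and finQ: "finite Q"
    and dA: "downset Q le A" and dC: "downset Q le C" and X_def: "X = A \<inter> C"
    and card_eq: "card A = card C" and m3: "3 \<le> card (A - C)"
    and sum_const: "\<And>Z. downset Q le Z \<Longrightarrow> X \<subseteq> Z \<Longrightarrow> Z \<subseteq> A \<union> C \<Longrightarrow> card Z = card A
      \<Longrightarrow> Z \<noteq> A \<Longrightarrow> Z \<noteq> C \<Longrightarrow> (\<Sum>z\<in>Z. down_degree Q le z) = \<kappa>"
begin

abbreviation m where "m \<equiv> card (A - C)"
abbreviation dg where "dg \<equiv> down_degree Q le"
abbreviation sg where "sg W \<equiv> \<Sum>z\<in>W. dg z"

lemma finA: "finite A" and finC: "finite C" and finX: "finite X"
  using finite_subset[OF downset_subset[OF dA] finQ] finite_subset[OF downset_subset[OF dC] finQ]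
  unfolding X_def by auto

lemma dX: "downset Q le X"
  unfolding X_def using downset_Int[OF dA dC] .

lemma card_A: "card A = card X + m"
  using card_Int_Diff[OF finA, of C] unfolding X_def by simp

lemma card_Diff_C_A: "card (C - A) = m"
  using card_Int_Diff[OF finC, of A] card_A card_eq unfolding X_def by (simp add: Int_commute)

lemma constant_degree_sum_swap: "constant_degree_sum Q le X C A \<kappa>"
proof
  show "X = C \<inter> A" "card C = card A" "3 \<le> card (C - A)"
    using X_def card_eq m3 card_Diff_C_A by auto
  show "(\<Sum>z\<in>Z. down_degree Q le z) = \<kappa>"
    if "downset Q le Z" "X \<subseteq> Z" "Z \<subseteq> C \<union> A" "card Z = card C" "Z \<noteq> C" "Z \<noteq> A" for Z
    using sum_const[of Z] that card_eq by (simp add: Un_commute)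
qed (use po finQ dA dC in auto)

lemma layer_exists: "s \<le> m \<Longrightarrow> \<exists>W. layer Q le X A s W"
  using downset_interpolate[OF po dX dA _ finA, of "card X + s"] card_A
  unfolding layer_def X_def by auto

lemma layer_card_Diff: "layer Q le X A s W \<Longrightarrow> card (W - X) = s"
  unfolding layer_def using finite_subset[OF _ finA] by (simp add: card_Diff_subset finX)

lemma layer_sum_dual:
  assumes W: "layer Q le X A s W" and V: "layer Q le X C t V"
    and "s + t = m" "1 \<le> s" "1 \<le> t"
  shows "sg W + sg V = \<kappa> + sg X"
proof -
  have dW: "downset Q le W" "X \<subseteq> W" "W \<subseteq> A" "card W = card X + s"
    and dV: "downset Q le V" "X \<subseteq> V" "V \<subseteq> C" "card V = card X + t"
    using W V unfolding layer_def by auto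
  have fW: "finite W" and fV: "finite V"
    using dW(3) dV(3) finA finC finite_subset by blast+
  have WV: "W \<inter> V = X"
    using dW(2,3) dV(2,3) unfolding X_def by blast
  have "card (W \<union> V) = card A"
    using card_Un_Int[OF fW fV] dW(4) dV(4) WV card_A assms(3) by simp
  moreover have "W - X \<noteq> {}" "V - X \<noteq> {}"
    using layer_card_Diff[OF W] constant_degree_sum.layer_card_Diff[OF constant_degree_sum_swap V]
      assms(4,5) by (metis card.empty not_one_le_zero)+
  then have "W \<union> V \<noteq> A" "W \<union> V \<noteq> C"
    using dW(3) dV(3) unfolding X_def by auto
  ultimately have "sg (W \<union> V) = \<kappa>"
    using sum_const[OF downset_Un[OF dW(1) dV(1)]] dW(2,3) dV(3) by auto
  then show ?thesis
    using sum.union_inter[OF fW fV, of dg] WV by simp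
qed

lemma layer_sum_eq:
  assumes W1: "layer Q le X A s W1" and W2: "layer Q le X A s W2" and "1 \<le> s" "s + 1 \<le> m"
  shows "sg W1 = sg W2"
proof -
  obtain V where V: "layer Q le X C (m - s) V"
    using constant_degree_sum.layer_exists[OF constant_degree_sum_swap, of "m - s"] card_Diff_C_A
    by auto
  have "sg W1 + sg V = \<kappa> + sg X" "sg W2 + sg V = \<kappa> + sg X"
    using layer_sum_dual[OF W1 V] layer_sum_dual[OF W2 V] assms(3,4) by auto
  then show ?thesis by simp
qed

lemma layer_remove:
  assumes W: "layer Q le X A s W" and e: "e \<in> W - X" and "downset Q le (W - {e})"
  shows "layer Q le X A (s - 1) (W - {e})" "1 \<le> s" "sg W = dg e + sg (W - {e})"
proof -
  have fW: "finite W"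
    using W finA finite_subset unfolding layer_def by blast
  show "1 \<le> s"
    using layer_card_Diff[OF W] e fW by (metis card_0_eq finite_Diff empty_iff less_one not_le)
  then show "layer Q le X A (s - 1) (W - {e})"
    using W e assms(3) fW unfolding layer_def by auto
  show "sg W = dg e + sg (W - {e})"
    using sum.remove[OF fW] e by blast
qed

lemma removable_degree_eq:
  assumes "removable Q le X A s e" "removable Q le X A s e'" "2 \<le> s" "s + 1 \<le> m"
  shows "dg e = dg e'"
proof -
  obtain W W' where W: "layer Q le X A s W" "e \<in> W - X" "downset Q le (W - {e})"
    and W': "layer Q le X A s W'" "e' \<in> W' - X" "downset Q le (W' - {e'})"
    using assms(1,2) unfolding removable_def by blast
  have "sg W = sg W'" "sg (W - {e}) = sg (W' - {e'})"
    using layer_sum_eq[OF W(1) W'(1)] layer_sum_eq[OF layer_remove(1)[OF W] layer_remove(1)[OF W']]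
      assms(3,4) by auto
  then show ?thesis
    using layer_remove(3)[OF W] layer_remove(3)[OF W'] by simp
qed

lemma layer_ex_maximal:
  assumes W: "layer Q le X A s W" and "1 \<le> s"
  obtains e where "e \<in> W - X" "\<forall>z\<in>W - X. le e z \<longrightarrow> z = e"
proof -
  have "W \<subseteq> A" "W \<subseteq> Q"
    using W downset_subset unfolding layer_def by auto
  then have "finite (W - X)" "W - X \<subseteq> Q"
    using finite_subset[OF _ finA] by auto
  moreover have "W - X \<noteq> {}"
    using layer_card_Diff[OF W] \<open>1 \<le> s\<close> by (metis card.empty not_one_le_zero)
  ultimately show thesis
    using finite_has_maximal_on[OF po] that by blast
qed

lemma removable_maximal:
  assumes W: "layer Q le X A s W" and e: "e \<in> W - X" "\<forall>z\<in>W - X. le e z \<longrightarrow> z = e"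
  shows "downset Q le (W - {e})" "removable Q le X A s e"
proof -
  show "downset Q le (W - {e})"
    using W downset_remove_maximal[OF _ dX e] unfolding layer_def by simp
  then show "removable Q le X A s e"
    using W e(1) unfolding removable_def by auto
qed

lemma removable_exists:
  assumes "1 \<le> s" "s \<le> m" shows "\<exists>e. removable Q le X A s e"
proof -
  obtain W where "layer Q le X A s W"
    using layer_exists[OF assms(2)] by blast
  then show ?thesis
    using layer_ex_maximal removable_maximal(2) assms(1) by metis
qed

text \<open>Remove the two topmost elements \<open>e\<^sub>1\<close>, \<open>e\<^sub>2\<close> from a layer of height \<open>s + 1\<close>: either
  \<open>e\<^sub>2\<close> lies below \<open>e\<^sub>1\<close>, or \<open>e\<^sub>2\<close> is removable at height \<open>s + 1\<close> as well.\<close>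

lemma removable_degree_mono:
  assumes "removable Q le X A s e'" "removable Q le X A (Suc s) e" "2 \<le> s" "s + 2 \<le> m"
  shows "dg e' \<le> dg e"
proof -
  obtain W where W: "layer Q le X A (Suc s) W"
    using layer_exists[of "Suc s"] assms(4) by auto
  obtain e1 where e1: "e1 \<in> W - X" "\<forall>z\<in>W - X. le e1 z \<longrightarrow> z = e1"
    using layer_ex_maximal[OF W] by auto
  have re1: "removable Q le X A (Suc s) e1"
    using removable_maximal(2)[OF W e1] .
  have W1: "layer Q le X A s (W - {e1})"
    using layer_remove(1)[OF W e1(1) removable_maximal(1)[OF W e1]] by simp
  obtain e2 where e2: "e2 \<in> (W - {e1}) - X" "\<forall>z\<in>(W - {e1}) - X. le e2 z \<longrightarrow> z = e2"
    using layer_ex_maximal[OF W1] assms(3) by auto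
  have "dg e2 \<le> dg e1"
  proof (cases "le e2 e1")
    case True
    moreover have "e1 \<in> Q" "e2 \<in> Q" "e2 \<noteq> e1"
      using e1(1) e2(1) W downset_subset unfolding layer_def by blast+
    ultimately show ?thesis
      using down_degree_strict_mono[OF po finQ] by fastforce
  next
    case False
    then have "removable Q le X A (Suc s) e2"
      using removable_maximal(2)[OF W] e2 by auto
    then show ?thesis
      using removable_degree_eq[OF _ re1] assms(3,4) by simp
  qed
  moreover have "dg e' = dg e2"
    using removable_degree_eq[OF assms(1) removable_maximal(2)[OF W1 e2]] assms(3,4) by simp
  moreover have "dg e = dg e1"
    using removable_degree_eq[OF assms(2) re1] assms(3,4) by simp
  ultimately show ?thesis by simp
qed

lemma removable_degree_dual:
  assumes "removable Q le X A (Suc s) e" "removable Q le X C (m - s) g" "1 \<le> s" "s + 2 \<le> m"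
  shows "dg e = dg g"
proof -
  interpret swap: constant_degree_sum Q le X C A \<kappa>
    by (rule constant_degree_sum_swap)
  obtain W where W: "layer Q le X A (Suc s) W" "e \<in> W - X" "downset Q le (W - {e})"
    using assms(1) unfolding removable_def by blast
  obtain V where V: "layer Q le X C (m - s) V" "g \<in> V - X" "downset Q le (V - {g})"
    using assms(2) unfolding removable_def by blast
  have "sg W + sg (V - {g}) = \<kappa> + sg X"
    using layer_sum_dual[OF W(1) swap.layer_remove(1)[OF V]] assms(3,4) by simp
  moreover have "sg (W - {e}) + sg V = \<kappa> + sg X"
    using layer_sum_dual[OF layer_remove(1)[OF W] V(1)] assms(3,4) by simp
  ultimately show ?thesis
    using layer_remove(3)[OF W] swap.layer_remove(3)[OF V] by simp
qed

text \<open>Degrees are nondecreasing in the height on both sides, and the duality between \<open>A\<close> and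
  \<open>C\<close> reverses heights.\<close>

lemma removable_degree_Suc:
  assumes "removable Q le X A k e" "removable Q le X A (Suc k) e'" "2 \<le> k" "k + 2 \<le> m"
  shows "dg e = dg e'"
proof -
  interpret swap: constant_degree_sum Q le X C A \<kappa>
    by (rule constant_degree_sum_swap)
  have bounds: "1 \<le> m - k" "m - k \<le> swap.m" "1 \<le> Suc (m - k)" "Suc (m - k) \<le> swap.m"
    using card_Diff_C_A assms(3,4) by auto
  obtain g where g: "removable Q le X C (Suc (m - k)) g"
    using swap.removable_exists[OF bounds(3,4)] by blast
  obtain g' where g': "removable Q le X C (m - k) g'"
    using swap.removable_exists[OF bounds(1,2)] by blast
  have "dg e = dg g"
    using removable_degree_dual[of "k - 1" e g] assms g by (simp add: Suc_diff_le)
  moreover have "dg e' = dg g'"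
    using removable_degree_dual[OF assms(2) g'] assms(3,4) by simp
  moreover have "dg g' \<le> dg g"
    using swap.removable_degree_mono[OF g' g] card_Diff_C_A assms(3,4) by simp
  moreover have "dg e \<le> dg e'"
    using removable_degree_mono[OF assms] .
  ultimately show ?thesis by simp
qed

lemma removable_degree_const:
  assumes "2 \<le> s" "s \<le> t" "t + 1 \<le> m" "removable Q le X A s e" "removable Q le X A t e'"
  shows "dg e = dg e'"
  using assms(2,3,5)
proof (induction t arbitrary: e' rule: dec_induct)
  case base
  then show ?case using removable_degree_eq[OF assms(4)] assms(1) by blast
next
  case (step t)
  obtain e'' where "removable Q le X A t e''"
    using removable_exists[of t] step assms(1) by auto
  then show ?case
    using step removable_degree_Suc[of t e'' e'] assms(1) by simp
qed

lemma removable_between: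
  assumes "downset Q le L" "downset Q le U" "X \<subseteq> L" "L \<subseteq> U" "U \<subseteq> A" "u \<in> L - X"
    and "\<forall>z\<in>U. le u z \<longrightarrow> z = u" "card L \<le> card X + s" "card X + s \<le> card U"
  shows "removable Q le X A s u"
proof -
  obtain W where W: "downset Q le W" "L \<subseteq> W" "W \<subseteq> U" "card W = card X + s"
    using downset_interpolate[OF po assms(1,2,4) finite_subset[OF assms(5) finA] assms(8,9)] by blast
  have "downset Q le (W - {u})"
    using downset_remove_maximal[OF W(1) downset_empty] assms(6,7) W(2,3) by blast
  then show ?thesis
    unfolding removable_def layer_def using W assms(3,5,6) by blast
qed

text \<open>A layer squeezed between \<open>X \<union> {y \<in> A. y \<le> u}\<close> and \<open>A\<close> minus the strict upper set of \<open>u\<close>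
  contains \<open>u\<close> as a maximal element.\<close>

lemma removable_principal:
  assumes u: "u \<in> A - C" and "card ({y\<in>A. le y u} - X) \<le> s"
    and "card X + s + card {y\<in>A. le u y \<and> y \<noteq> u} \<le> card A"
  shows "removable Q le X A s u"
proof -
  define Dn Up where "Dn = {y\<in>A. le y u}" and "Up = {y\<in>A. le u y \<and> y \<noteq> u}"
  have AQ: "A \<subseteq> Q" and uQ: "u \<in> Q"
    using u dA downset_subset by auto
  have "Dn = A \<inter> {y\<in>Q. le y u}" "A - Up = A \<inter> {y\<in>Q. \<not> (le u y \<and> y \<noteq> u)}"
    unfolding Dn_def Up_def using AQ by auto
  then have dL: "downset Q le (X \<union> Dn)" and dU: "downset Q le (A - Up)"
    using downset_Un[OF dX downset_Int[OF dA downset_atMost[OF po uQ]]]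
      downset_Int[OF dA downset_not_above[OF po uQ]] by simp_all
  have "X \<inter> Up = {}" "Dn \<inter> Up = {}"
    using downsetD[OF dC _ uQ] u partial_order_on'_antisym[OF po _ uQ] AQ
    unfolding X_def Dn_def Up_def by auto
  then have "X \<union> Dn \<subseteq> A - Up"
    unfolding X_def Dn_def by auto
  moreover have "card (X \<union> Dn) \<le> card X + s"
    using card_Un_le[of X "Dn - X"] assms(2) unfolding Dn_def by (simp add: Un_Diff_cancel)
  moreover have "card (A - Up) = card A - card Up"
    using card_Diff_subset[of Up A] finite_subset[OF _ finA] unfolding Up_def by auto
  then have "card X + s \<le> card (A - Up)"
    using assms(3) unfolding Up_def by simp
  moreover have "\<forall>z\<in>A - Up. le u z \<longrightarrow> z = u" "u \<in> (X \<union> Dn) - X"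
    using u partial_order_on'_refl[OF po uQ] unfolding Up_def Dn_def X_def by auto
  ultimately show ?thesis
    using removable_between[OF dL dU] by blast
qed

lemma non_extremal_removable:
  assumes u: "u \<in> A - C" and ne: "non_extremal le (A - C) u"
  shows "\<exists>s. 2 \<le> s \<and> s + 1 \<le> m \<and> removable Q le X A s u"
proof -
  define Dn Up where "Dn = {y\<in>A. le y u} - X" and "Up = {y\<in>A. le u y \<and> y \<noteq> u}"
  obtain yb yt where yb: "yb \<in> A - C" "\<not> le u yb" and yt: "yt \<in> A - C" "\<not> le yt u"
    using ne unfolding non_extremal_def by blast
  have uQ: "u \<in> Q"
    using u dA downset_subset by auto
  have fin: "finite (A - C)"
    using finA by simp
  have sub: "Dn \<subseteq> (A - C) - {yt}" "Up \<subseteq> (A - C) - {yb, u}"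
    using yt yb downsetD[OF dC _ uQ] u unfolding X_def Dn_def Up_def by auto
  have "yb \<noteq> u"
    using yb partial_order_on'_refl[OF po uQ] by auto
  then have "card ((A - C) - {yt}) = m - 1" "card ((A - C) - {yb, u}) = m - 2"
    using yt yb u fin by (auto simp: card_Diff_subset)
  then have a: "card Dn \<le> m - 1" and b: "card Up \<le> m - 2"
    using card_mono[OF finite_Diff[OF fin] sub(1)] card_mono[OF finite_Diff[OF fin] sub(2)] by simp_all
  have "Dn \<inter> Up = {}"
    using partial_order_on'_antisym[OF po _ uQ] dA downset_subset unfolding Dn_def Up_def by blast
  then have "card Dn + card Up = card (Dn \<union> Up)"
    using card_Un_disjoint[of Dn Up] finite_subset[OF sub(1)] finite_subset[OF sub(2)] fin by simp
  also have "\<dots> \<le> m"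
    using card_mono[OF fin, of "Dn \<union> Up"] sub by auto
  finally have "card Dn + card Up \<le> m" .
  define s where "s = max 2 (card Dn)"
  then have "2 \<le> s" "s + 1 \<le> m" "card Dn \<le> s" "card X + s + card Up \<le> card A"
    using a b \<open>card Dn + card Up \<le> m\<close> m3 card_A by auto
  then have "removable Q le X A s u"
    using removable_principal[OF u] unfolding Dn_def Up_def by blast
  then show ?thesis
    using \<open>2 \<le> s\<close> \<open>s + 1 \<le> m\<close> by blast
qed

lemma non_extremal_comparable_eq:
  assumes "u \<in> A - C" "v \<in> A - C" "non_extremal le (A - C) u" "non_extremal le (A - C) v"
    and "le u v"
  shows "u = v"
proof (rule ccontr)
  assume "u \<noteq> v"
  obtain s t where s: "2 \<le> s" "s + 1 \<le> m" "removable Q le X A s u"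
    and t: "2 \<le> t" "t + 1 \<le> m" "removable Q le X A t v"
    using non_extremal_removable assms(1-4) by meson
  have "dg u = dg v"
    using removable_degree_const[OF s(1) _ t(2) s(3) t(3)] removable_degree_const[OF t(1) _ s(2) t(3) s(3)]
    by (cases "s \<le> t") auto
  moreover have "dg u < dg v"
    using down_degree_strict_mono[OF po finQ _ _ assms(5) \<open>u \<noteq> v\<close>] assms(1,2) dA downset_subset
    by blast
  ultimately show False by simp
qed

lemma antichain_with_ends_Diff: "antichain_with_ends le (A - C)"
proof (rule antichain_with_endsI[OF po])
  show "A - C \<subseteq> Q" "finite (A - C)"
    using downset_subset[OF dA] finA by auto
qed (rule non_extremal_comparable_eq)

end

section \<open>Minimal special paths\<close>

text \<open>For a witness of pairwise non-isomorphic posets, \<open>THE\<close> picks the unique member of \<open>G\<close>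
  isomorphic to an \<open>n\<close>-downset (lemma \<open>shape\<close> below).\<close>

definition shape :: "('b set \<times> ('b \<Rightarrow> 'b \<Rightarrow> bool)) set \<Rightarrow> ('a \<Rightarrow> 'a \<Rightarrow> bool) \<Rightarrow> 'a set
    \<Rightarrow> 'b set \<times> ('b \<Rightarrow> 'b \<Rightarrow> bool)" where
  "shape G le D = (THE P. P \<in> G \<and> poset_iso D le (fst P) (snd P))"

definition intermediate :: "'a set \<Rightarrow> ('a \<Rightarrow> 'a \<Rightarrow> bool) \<Rightarrow> nat \<Rightarrow> 'a set \<Rightarrow> 'a set \<Rightarrow> 'a set \<Rightarrow> bool" where
  "intermediate Q le n A C Z \<longleftrightarrow> ndownset Q le n Z \<and> A \<inter> C \<subseteq> Z \<and> Z \<subseteq> A \<union> C \<and> Z \<noteq> A \<and> Z \<noteq> C"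

lemma intermediate_commute: "intermediate Q le n A C Z \<longleftrightarrow> intermediate Q le n C A Z"
  unfolding intermediate_def Int_commute[of A C] Un_commute[of A C] by auto

locale minimal_special_path =
  fixes Q :: "'a set" and le :: "'a \<Rightarrow> 'a \<Rightarrow> bool" and n :: nat
    and SA SB SC :: "'b set" and rA rB rC :: "'b \<Rightarrow> 'b \<Rightarrow> bool"
    and G :: "('b set \<times> ('b \<Rightarrow> 'b \<Rightarrow> bool)) set" and vs :: "'a set list"
  assumes po: "partial_order_on' Q le" and finQ: "finite Q"
    and nAB: "\<not> poset_iso SA rA SB rB" and nAC: "\<not> poset_iso SA rA SC rC"
    and nBC: "\<not> poset_iso SB rB SC rC"
    and G_def: "G = {(SA, rA), (SB, rB), (SC, rC)}"
    and wit: "witness Q le n G"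
    and spec: "special_path Q le n G vs"
    and minimal: "\<forall>ws. special_path Q le n G ws \<longrightarrow> length vs \<le> length ws"
    and isoA: "poset_iso (hd vs) le SA rA"
    and isoB: "\<forall>i. 0 < i \<and> i < length vs - 1 \<longrightarrow> poset_iso (vs ! i) le SB rB"
    and isoC: "poset_iso (last vs) le SC rC"
begin

abbreviation nd where "nd \<equiv> ndownset Q le n"
abbreviation sh where "sh \<equiv> shape G le"
abbreviation inter where "inter \<equiv> intermediate Q le n (hd vs) (last vs)"

lemma shapes_distinct: "(SA, rA) \<noteq> (SB, rB)" "(SA, rA) \<noteq> (SC, rC)" "(SB, rB) \<noteq> (SC, rC)"
  using nAB nAC nBC poset_iso_refl by fastforce+

lemma shape_unique:
  assumes "P \<in> G" "P' \<in> G" "poset_iso D le (fst P) (snd P)" "poset_iso D le (fst P') (snd P')"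
  shows "P = P'"
proof -
  have "poset_iso (fst P) (snd P) (fst P') (snd P')"
    using poset_iso_trans[OF poset_iso_sym[OF assms(3)] assms(4)] .
  moreover have "\<not> poset_iso SB rB SA rA" "\<not> poset_iso SC rC SA rA" "\<not> poset_iso SC rC SB rB"
    using nAB nAC nBC poset_iso_sym by blast+
  ultimately show ?thesis
    using assms(1,2) nAB nAC nBC unfolding G_def by auto
qed

lemma shape:
  assumes "nd D" shows "sh D \<in> G" "poset_iso D le (fst (sh D)) (snd (sh D))"
proof -
  obtain P where P: "P \<in> G" "poset_iso D le (fst P) (snd P)"
    using wit assms unfolding witness_def by blast
  have "sh D = P"
    unfolding shape_def using P shape_unique by blast
  then show "sh D \<in> G" "poset_iso D le (fst (sh D)) (snd (sh D))"
    using P by simp_all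
qed

lemma shape_eqI: "nd D \<Longrightarrow> P \<in> G \<Longrightarrow> poset_iso D le (fst P) (snd P) \<Longrightarrow> sh D = P"
  using shape shape_unique by blast

lemma vs_path: "exch_path Q le n vs" and length_vs: "3 \<le> length vs"
  using spec unfolding special_path_def by blast+

lemma vs_nd: "i < length vs \<Longrightarrow> nd (vs ! i)"
  using exch_path_nth[OF vs_path] .

lemma vs_ne: "vs \<noteq> []"
  using length_vs by auto

lemma nd_hd: "nd (hd vs)" and nd_last: "nd (last vs)"
  using vs_nd[of 0] vs_nd[of "length vs - 1"] vs_ne by (simp_all add: hd_conv_nth last_conv_nth)

lemma shape_hd: "sh (hd vs) = (SA, rA)"
  using shape_eqI[OF nd_hd] isoA G_def by simp

lemma shape_last: "sh (last vs) = (SC, rC)"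
  using shape_eqI[OF nd_last] isoC G_def by simp

lemma shape_inner: "0 < i \<Longrightarrow> i < length vs - 1 \<Longrightarrow> sh (vs ! i) = (SB, rB)"
  using shape_eqI[OF vs_nd] isoB G_def by simp

lemma shape_other:
  assumes "nd D1" "nd D2" "nd D3" "nd D" "sh D1 \<noteq> sh D2" "sh D2 \<noteq> sh D3" "sh D1 \<noteq> sh D3"
    and "sh D \<noteq> sh D2"
  shows "sh D = sh D1 \<or> sh D = sh D3"
  using shape(1)[OF assms(1)] shape(1)[OF assms(2)] shape(1)[OF assms(3)] shape(1)[OF assms(4)]
    assms(5-8) unfolding G_def by auto

lemma special_segment:
  assumes ws: "exch_path Q le n ws" and "i < j" "j < l" "l < length ws"
    and "sh (ws ! i) \<noteq> sh (ws ! j)" "sh (ws ! j) \<noteq> sh (ws ! l)" "sh (ws ! i) \<noteq> sh (ws ! l)"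
    and same: "\<forall>k. i < k \<and> k < l \<longrightarrow> sh (ws ! k) = sh (ws ! j)"
  shows "length vs \<le> Suc (l - i)"
proof -
  define seg where "seg = take (Suc (l - i)) (drop i ws)"
  have len: "length seg = Suc (l - i)" and nth: "\<And>k. k < length seg \<Longrightarrow> seg ! k = ws ! (i + k)"
    unfolding seg_def using assms(2-4) by auto
  have nd: "\<And>k. k < length ws \<Longrightarrow> nd (ws ! k)"
    using exch_path_nth[OF ws] .
  have "seg \<noteq> []" using len by auto
  then have ends: "hd seg = ws ! i" "last seg = ws ! l"
    using nth[of 0] nth[of "l - i"] len assms(2,3) by (simp_all add: hd_conv_nth last_conv_nth)
  have inner: "poset_iso (seg ! k) le (fst (sh (ws ! j))) (snd (sh (ws ! j)))"
    if "0 < k" "k < length seg - 1" for k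
    using that nth[of k] same[rule_format, of "i + k"] shape(2)[OF nd, of "i + k"] len assms(4) by simp
  have "\<exists>P1\<in>G. \<exists>P2\<in>G. \<exists>P3\<in>G. P1 \<noteq> P2 \<and> P1 \<noteq> P3 \<and> P2 \<noteq> P3 \<and>
      poset_iso (hd seg) le (fst P1) (snd P1) \<and>
      (\<forall>k. 0 < k \<and> k < length seg - 1 \<longrightarrow> poset_iso (seg ! k) le (fst P2) (snd P2)) \<and>
      poset_iso (last seg) le (fst P3) (snd P3)"
    by (rule bexI[of _ "sh (ws ! i)"], rule bexI[of _ "sh (ws ! j)"], rule bexI[of _ "sh (ws ! l)"])
      (use ends inner assms(2-7) shape[OF nd] in auto)
  moreover have "exch_path Q le n seg" "3 \<le> length seg"
    unfolding seg_def using exch_path_segment[OF ws _ assms(4)] assms(2,3) len seg_def by auto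
  ultimately have "special_path Q le n G seg"
    unfolding special_path_def by (intro conjI) assumption+
  then show ?thesis
    using minimal len by auto
qed

text \<open>A triple of pairwise distinct shapes of minimal span spans a special path.\<close>

lemma three_shapes_span:
  assumes ws: "exch_path Q le n ws" and "i < j" "j < l" "l < length ws"
    and "sh (ws ! i) \<noteq> sh (ws ! j)" "sh (ws ! j) \<noteq> sh (ws ! l)" "sh (ws ! i) \<noteq> sh (ws ! l)"
  shows "length vs \<le> Suc (l - i)"
proof -
  have nd: "\<And>k. k < length ws \<Longrightarrow> nd (ws ! k)"
    using exch_path_nth[OF ws] .
  obtain d where "l - i = d" by simp
  then show ?thesis
    using assms(2-7)
  proof (induction d arbitrary: i j l rule: less_induct)
    case (less d)
    show ?case
    proof (cases "\<forall>k. i < k \<and> k < l \<longrightarrow> sh (ws ! k) = sh (ws ! j)")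
      case True
      then show ?thesis using special_segment[OF ws less.prems(2-7)] by blast
    next
      case False
      then obtain k where k: "i < k" "k < l" "sh (ws ! k) \<noteq> sh (ws ! j)" by blast
      have "nd (ws ! i)" "nd (ws ! j)" "nd (ws ! l)" "nd (ws ! k)"
        using nd less.prems k by simp_all
      then have "sh (ws ! k) = sh (ws ! i) \<or> sh (ws ! k) = sh (ws ! l)"
        using shape_other less.prems(5-7) k(3) by blast
      moreover have "k \<noteq> j" using k by blast
      ultimately consider "sh (ws ! k) = sh (ws ! i)" "k < j" | "sh (ws ! k) = sh (ws ! i)" "j < k"
        | "sh (ws ! k) = sh (ws ! l)" "k < j" | "sh (ws ! k) = sh (ws ! l)" "j < k"
        by linarith
      then show ?thesis
      proof cases
        case 1
        then have "length vs \<le> Suc (l - k)"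
          using less.IH[where y="l - k" and i=k and j=j and l=l] less.prems k by auto
        then show ?thesis using k by linarith
      next
        case 2
        then have "length vs \<le> Suc (l - j)"
          using less.IH[where y="l - j" and i=j and j=k and l=l] less.prems k by auto
        then show ?thesis using less.prems by linarith
      next
        case 3
        then have "length vs \<le> Suc (j - i)"
          using less.IH[where y="j - i" and i=i and j=k and l=j] less.prems k by auto
        then show ?thesis using less.prems by linarith
      next
        case 4
        then have "length vs \<le> Suc (k - i)"
          using less.IH[where y="k - i" and i=i and j=j and l=k] less.prems k by auto
        then show ?thesis using k by linarith
      qed
    qed
  qed
qed

lemma interval_shape:
  assumes "nd D" "nd E" "nd Z" "D \<inter> E \<subseteq> Z" "Z \<subseteq> D \<union> E" "sh D \<noteq> sh E"
    and "Suc (card (D - E)) < length vs"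
  shows "sh Z = sh D \<or> sh Z = sh E"
proof (rule ccontr)
  assume Z: "\<not> (sh Z = sh D \<or> sh Z = sh E)"
  obtain ws where ws: "exch_path Q le n ws" "hd ws = D" "last ws = E" "Z \<in> set ws"
    "length ws = Suc (card (D - E))"
    using exch_path_geodesic[OF po assms(1-5)] by blast
  obtain j where j: "j < length ws" "ws ! j = Z"
    using ws(4) by (meson in_set_conv_nth)
  have "ws \<noteq> []" using ws(5) by auto
  then have ends: "ws ! 0 = D" "ws ! (length ws - 1) = E"
    using ws(2,3) by (metis hd_conv_nth, metis last_conv_nth)
  moreover have "Z \<noteq> D" "Z \<noteq> E" using Z by auto
  ultimately have "j \<noteq> 0" "j \<noteq> length ws - 1"
    using j by auto
  then have "0 < j" "j < length ws - 1"
    using j(1) by auto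
  then have "length vs \<le> Suc (length ws - 1 - 0)"
    using three_shapes_span[OF ws(1), of 0 j "length ws - 1"] j Z assms(6)
      ends by auto
  then show False
    using ws(5) assms(7) by simp
qed

lemma adjacent_shape:
  assumes "4 \<le> length vs" "nd U" "nd Y" "nd V" "exch_adj U Y" "exch_adj Y V" "sh U \<noteq> sh V"
  shows "sh Y = sh U \<or> sh Y = sh V"
proof (rule ccontr)
  assume Y: "\<not> (sh Y = sh U \<or> sh Y = sh V)"
  then have "U \<noteq> Y" "Y \<noteq> V" "U \<noteq> V"
    using assms(7) by auto
  have "exch_path Q le n [U, Y, V]"
    unfolding exch_path_def
  proof (intro conjI allI impI)
    fix i assume "Suc i < length [U, Y, V]"
    then have "i = 0 \<or> i = 1" by auto
    then show "exch_adj ([U, Y, V] ! i) ([U, Y, V] ! Suc i)"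
      using assms(5,6) by auto
  qed (use assms(2-4) \<open>U \<noteq> Y\<close> \<open>Y \<noteq> V\<close> \<open>U \<noteq> V\<close> in auto)
  then have "length vs \<le> 3"
    using three_shapes_span[of "[U, Y, V]" 0 1 2] Y assms(7) by auto
  then show False
    using assms(1) by simp
qed

lemma minimal_special_path_rev: "minimal_special_path Q le n SC SB SA rC rB rA G (rev vs)"
proof
  show "\<not> poset_iso SC rC SB rB" "\<not> poset_iso SC rC SA rA" "\<not> poset_iso SB rB SA rA"
    using nAB nAC nBC poset_iso_sym by blast+
  show "G = {(SC, rC), (SB, rB), (SA, rA)}"
    using G_def by auto
  show "special_path Q le n G (rev vs)"
    using special_path_rev[OF spec] .
  show "poset_iso (hd (rev vs)) le SC rC" "poset_iso (last (rev vs)) le SA rA"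
    using isoC isoA vs_ne by (simp_all add: hd_rev last_rev)
  show "\<forall>i. 0 < i \<and> i < length (rev vs) - 1 \<longrightarrow> poset_iso (rev vs ! i) le SB rB"
  proof (intro allI impI)
    fix i assume i: "0 < i \<and> i < length (rev vs) - 1"
    then have "0 < length vs - Suc i" "length vs - Suc i < length vs - 1"
      by auto
    then show "poset_iso (rev vs ! i) le SB rB"
      using isoB i by (simp add: rev_nth)
  qed
qed (use po finQ wit minimal in auto)

lemma card_Diff_hd_last: "card (hd vs - last vs) = card (last vs - hd vs)"
proof -
  have "finite (hd vs)" "finite (last vs)" "card (hd vs) = card (last vs)"
    using nd_hd nd_last unfolding ndownset_def by auto
  then show ?thesis
    by (metis Int_commute card_Int_Diff add_left_cancel)
qed

lemma card_Diff_hd_last_le: "Suc (card (hd vs - last vs)) \<le> length vs"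
  using exch_path_card_Diff[OF vs_path, of 0 "length vs - 1"] vs_ne length_vs
  by (simp add: hd_conv_nth last_conv_nth)

lemma intermediate_card_Diff:
  assumes "inter Z" shows "card (Z - last vs) < card (hd vs - last vs)"
proof -
  have "Z - last vs \<subseteq> hd vs - last vs"
    using assms unfolding intermediate_def by blast
  moreover have "Z - last vs \<noteq> hd vs - last vs"
  proof
    assume "Z - last vs = hd vs - last vs"
    then have "hd vs \<subseteq> Z"
      using assms unfolding intermediate_def by blast
    then show False
      using assms nd_hd card_subset_eq[of Z "hd vs"] unfolding intermediate_def ndownset_def by auto
  qed
  moreover have "finite (hd vs)"
    using nd_hd unfolding ndownset_def by simp
  ultimately show ?thesis
    by (meson finite_Diff psubsetI psubset_card_mono)
qed

lemma ex_intermediate_shape_B: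
  assumes m3: "3 \<le> card (hd vs - last vs)"
  shows "\<exists>W. inter W \<and> sh W = (SB, rB)"
proof -
  define A C v1 where "A = hd vs" and "C = last vs" and "v1 = vs ! 1"
  have len: "4 \<le> length vs"
    using card_Diff_hd_last_le m3 by simp
  have ndA: "nd A" and ndC: "nd C" and ndv1: "nd v1"
    unfolding A_def C_def v1_def using nd_hd nd_last vs_nd len by auto
  have shA: "sh A = (SA, rA)" and shC: "sh C = (SC, rC)" and shv1: "sh v1 = (SB, rB)"
    unfolding A_def C_def v1_def using shape_hd shape_last shape_inner[of 1] len by auto
  have "exch_adj A v1"
    unfolding A_def v1_def using exch_path_adj[OF vs_path, of 0] len vs_ne by (simp add: hd_conv_nth)
  then obtain x y where x: "A - v1 = {x}" and y: "v1 - A = {y}"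
    by (rule exch_adjE)
  then have xy: "x \<in> A" "x \<notin> v1" "y \<in> v1" "y \<notin> A" and v1_eq: "v1 = insert y (A - {x})"
    by blast+
  have "card (v1 - C) \<le> length vs - 2"
    using exch_path_card_Diff[OF vs_path, of 1 "length vs - 1"] len vs_ne
    unfolding v1_def C_def by (simp add: last_conv_nth numeral_2_eq_2)
  then have near_C: "sh W = (SB, rB) \<or> sh W = (SC, rC)"
    if "nd W" "v1 \<inter> C \<subseteq> W" "W \<subseteq> v1 \<union> C" for W
    using interval_shape[OF ndv1 ndC that] shv1 shC shapes_distinct len by simp
  have interI: "inter W" if "nd W" "A \<inter> C \<subseteq> W" "W \<subseteq> A \<union> C" "sh W = (SB, rB)" for W
  proof -
    have "W \<noteq> A" "W \<noteq> C"
      using that(4) shA shC shapes_distinct by auto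
    then show ?thesis
      unfolding intermediate_def A_def[symmetric] C_def[symmetric] using that(1-3) by blast
  qed
  consider "x \<in> C" "y \<notin> C" | "x \<notin> C" "y \<in> C" | "y \<in> C \<longleftrightarrow> x \<in> C"
    by blast
  then show ?thesis
  proof cases
    case 1
    then have "v1 \<inter> C \<subseteq> A" "A \<subseteq> v1 \<union> C"
      using xy v1_eq by auto
    then show ?thesis
      using near_C[OF ndA] shA shapes_distinct by auto
  next
    case 2
    then have "A \<inter> C \<subseteq> v1" "v1 \<subseteq> A \<union> C"
      using xy v1_eq by auto
    then show ?thesis
      using interI ndv1 shv1 by blast
  next
    case 3
    moreover have "v1 \<noteq> C"
      using shv1 shC shapes_distinct by auto
    ultimately obtain Y where Y: "nd Y" "A \<inter> C \<subseteq> Y" "Y \<subseteq> A \<union> C" "v1 \<inter> C \<subseteq> Y" "Y \<subseteq> v1 \<union> C"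
      and adj: "exch_adj A Y" "exch_adj Y v1"
      using exch_adj_square[OF po ndA ndv1 ndC x y] by blast
    have "sh Y = sh A \<or> sh Y = sh v1"
      using adjacent_shape[OF len ndA Y(1) ndv1 adj] shA shv1 shapes_distinct by auto
    then have "sh Y = (SB, rB)"
      using near_C[OF Y(1,4,5)] shA shv1 shapes_distinct by auto
    then show ?thesis
      using interI Y(1-3) by blast
  qed
qed

lemma intermediate_not_adjacent_A_B:
  assumes m3: "3 \<le> card (hd vs - last vs)" and Z: "inter Z" and W: "inter W"
    and adj: "exch_adj Z W" and shZ: "sh Z = (SA, rA)" and shW: "sh W = (SB, rB)"
  shows False
proof -
  define C where "C = last vs"
  have len: "4 \<le> length vs"
    using card_Diff_hd_last_le m3 by simp
  have ndZ: "nd Z" and ndW: "nd W" and ndC: "nd C" and "W \<noteq> C"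
    using Z W nd_last unfolding intermediate_def C_def by auto
  have near_C: "sh Y = sh U \<or> sh Y = (SC, rC)"
    if "inter U" "nd Y" "U \<inter> C \<subseteq> Y" "Y \<subseteq> U \<union> C" "sh U \<noteq> (SC, rC)" for U Y
  proof -
    have "nd U" using that(1) unfolding intermediate_def by simp
    moreover have "Suc (card (U - C)) < length vs"
      using intermediate_card_Diff[OF that(1)] card_Diff_hd_last_le unfolding C_def by simp
    ultimately show ?thesis
      using interval_shape[OF _ ndC that(2-4)] that(5) shape_last unfolding C_def by auto
  qed
  obtain f e where f: "Z - W = {f}" and e: "W - Z = {e}"
    using adj by (rule exch_adjE)
  then have ef: "f \<in> Z" "f \<notin> W" "e \<in> W" "e \<notin> Z" and W_eq: "W = insert e (Z - {f})"
    by blast+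
  consider "e \<notin> C" "f \<in> C" | "e \<in> C" "f \<notin> C" | "e \<in> C \<longleftrightarrow> f \<in> C"
    by blast
  then show False
  proof cases
    case 1
    then have "W \<inter> C \<subseteq> Z" "Z \<subseteq> W \<union> C"
      using ef W_eq by auto
    then show False
      using near_C[OF W ndZ] shZ shW shapes_distinct by auto
  next
    case 2
    then have "Z \<inter> C \<subseteq> W" "W \<subseteq> Z \<union> C"
      using ef W_eq by auto
    then show False
      using near_C[OF Z ndW] shZ shW shapes_distinct by auto
  next
    case 3
    then obtain Y where Y: "nd Y" "Z \<inter> C \<subseteq> Y" "Y \<subseteq> Z \<union> C" "W \<inter> C \<subseteq> Y" "Y \<subseteq> W \<union> C"
      and adjY: "exch_adj Z Y" "exch_adj Y W"
      using exch_adj_square[OF po ndZ ndW ndC f e] \<open>W \<noteq> C\<close> by blast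
    have "sh Y = (SC, rC)"
      using near_C[OF W Y(1,4,5)] near_C[OF Z Y(1-3)] shZ shW shapes_distinct by auto
    then show False
      using adjacent_shape[OF len ndZ Y(1) ndW adjY] shZ shW shapes_distinct by auto
  qed
qed

lemma intermediate_not_adjacent_C_B:
  assumes "3 \<le> card (hd vs - last vs)" "inter Z" "inter W" "exch_adj Z W"
    and "sh Z = (SC, rC)" "sh W = (SB, rB)"
  shows False
proof -
  interpret rev: minimal_special_path Q le n SC SB SA rC rB rA G "rev vs"
    by (rule minimal_special_path_rev)
  have ends: "hd (rev vs) = last vs" "last (rev vs) = hd vs"
    using vs_ne by (simp_all add: hd_rev last_rev)
  show False
    using rev.intermediate_not_adjacent_A_B[of Z W] assms card_Diff_hd_last
      intermediate_commute[of Q le n "hd vs" "last vs"] unfolding ends by simp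
qed

lemma intermediate_path_shape_B:
  assumes m3: "3 \<le> card (hd vs - last vs)" and ws: "exch_path Q le n ws"
    and inter: "\<forall>W\<in>set ws. inter W" and hd: "sh (hd ws) = (SB, rB)"
  shows "sh (last ws) = (SB, rB)"
proof -
  have "ws \<noteq> []" using ws unfolding exch_path_def by simp
  have "sh (ws ! k) = (SB, rB)" if "k < length ws" for k
    using that
  proof (induction k)
    case 0
    then show ?case using hd \<open>ws \<noteq> []\<close> by (simp add: hd_conv_nth)
  next
    case (Suc k)
    have Ik: "inter (ws ! k)" and Isk: "inter (ws ! Suc k)"
      using inter Suc.prems by simp_all
    have adj: "exch_adj (ws ! Suc k) (ws ! k)"
      using exch_adj_sym[OF exch_path_adj[OF ws Suc.prems]] .
    have "sh (ws ! k) = (SB, rB)"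
      using Suc by simp
    then have "sh (ws ! Suc k) \<noteq> (SA, rA)" "sh (ws ! Suc k) \<noteq> (SC, rC)"
      using intermediate_not_adjacent_A_B[OF m3 Isk Ik adj]
        intermediate_not_adjacent_C_B[OF m3 Isk Ik adj] by auto
    then show ?case
      using shape(1)[OF exch_path_nth[OF ws Suc.prems]] G_def by auto
  qed
  then show ?thesis
    using \<open>ws \<noteq> []\<close> by (simp add: last_conv_nth)
qed

text \<open>The geodesic from \<open>Z\<^sub>1\<close> to \<open>Z\<^sub>2\<close> keeps \<open>p\<close> and \<open>q\<close>, so it never reaches \<open>hd vs\<close> or \<open>last vs\<close>.\<close>

lemma intermediate_shape_B_transfer:
  assumes m3: "3 \<le> card (hd vs - last vs)" and Z1: "inter Z1" and Z2: "inter Z2"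
    and sh1: "sh Z1 = (SB, rB)"
    and p: "p \<in> Z1 \<inter> Z2" "p \<notin> last vs" and q: "q \<in> Z1 \<inter> Z2" "q \<notin> hd vs"
  shows "sh Z2 = (SB, rB)"
proof -
  have nd1: "nd Z1" and nd2: "nd Z2"
    using Z1 Z2 unfolding intermediate_def by simp_all
  obtain ws where ws: "exch_path Q le n ws" "hd ws = Z1" "last ws = Z2" "Z2 \<in> set ws"
    "length ws = Suc (card (Z1 - Z2))" "\<forall>W\<in>set ws. Z1 \<inter> Z2 \<subseteq> W \<and> W \<subseteq> Z1 \<union> Z2"
    using exch_path_geodesic[OF po nd1 nd2 nd2 Int_lower2 Un_upper2] by (elim exE conjE) (rule that)
  have "inter W" if "W \<in> set ws" for W
  proof -
    have "nd W"
      using ws(1) that unfolding exch_path_def by blast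
    moreover have "Z1 \<inter> Z2 \<subseteq> W" "W \<subseteq> Z1 \<union> Z2"
      using ws(6) that by auto
    then have "hd vs \<inter> last vs \<subseteq> W" "W \<subseteq> hd vs \<union> last vs" "W \<noteq> hd vs" "W \<noteq> last vs"
      using Z1 Z2 p q unfolding intermediate_def by auto
    ultimately show ?thesis
      unfolding intermediate_def by simp
  qed
  then show ?thesis
    using intermediate_path_shape_B[OF m3 ws(1)] ws(2,3) sh1 by blast
qed

lemma intermediate_anchors:
  assumes "inter V"
  obtains p q where "p \<in> V" "p \<notin> last vs" "minimal_over Q le (hd vs \<inter> last vs) p"
    and "q \<in> V" "q \<notin> hd vs" "minimal_over Q le (hd vs \<inter> last vs) q"
proof -
  have ndV: "nd V" and sub: "V \<subseteq> hd vs \<union> last vs" "V \<subseteq> last vs \<union> hd vs"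
    and ne: "V \<noteq> last vs" "V \<noteq> hd vs"
    using assms unfolding intermediate_def by auto
  have dV: "downset Q le V" and fV: "finite V"
    using ndV unfolding ndownset_def by auto
  have dA: "downset Q le (hd vs)" and dC: "downset Q le (last vs)"
    using nd_hd nd_last unfolding ndownset_def by auto
  obtain p where "p \<in> V - last vs" "minimal_over Q le (hd vs \<inter> last vs) p"
    using ex_minimal_over[OF po dA dC dV sub(1) fV] ndownset_Diff_ne[OF ndV nd_last ne(1)] by blast
  moreover obtain q where "q \<in> V - hd vs" "minimal_over Q le (last vs \<inter> hd vs) q"
    using ex_minimal_over[OF po dC dA dV sub(2) fV] ndownset_Diff_ne[OF ndV nd_hd ne(2)] by blast
  ultimately show thesis
    using that by (simp add: Int_commute) blast
qed

lemma ex_intermediate_superset: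
  assumes m3: "3 \<le> card (hd vs - last vs)"
    and S: "S \<subseteq> hd vs \<union> last vs" "card S \<le> 3" "\<forall>s\<in>S. minimal_over Q le (hd vs \<inter> last vs) s"
    and p: "p \<in> S" "p \<notin> last vs" and q: "q \<in> S" "q \<notin> hd vs"
  shows "\<exists>Z. inter Z \<and> S \<subseteq> Z"
proof -
  define A C where "A = hd vs" and "C = last vs"
  have ndA: "nd A" and ndC: "nd C"
    unfolding A_def C_def using nd_hd nd_last by simp_all
  have dA: "downset Q le A" and dC: "downset Q le C" and finA: "finite A" and finC: "finite C"
    using ndA ndC unfolding ndownset_def by auto
  have "S \<subseteq> Q"
    using S(1) downset_subset[OF dA] downset_subset[OF dC] unfolding A_def C_def by auto
  then have dL: "downset Q le (A \<inter> C \<union> S)"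
    using downset_Un_minimal_over[OF downset_Int[OF dA dC]] S(3) unfolding A_def C_def by simp
  have "card (A \<inter> C \<union> S) \<le> card (A \<inter> C) + card (A - C)"
    using card_Un_le[of "A \<inter> C" S] S(2) m3 unfolding A_def C_def by linarith
  also have "\<dots> = n"
    using card_Int_Diff[OF finA, of C] ndA unfolding ndownset_def by simp
  finally have "card (A \<inter> C \<union> S) \<le> n" .
  moreover have "n \<le> card (A \<union> C)"
    using ndA card_mono[of "A \<union> C" A] finA finC unfolding ndownset_def by simp
  moreover have "A \<inter> C \<union> S \<subseteq> A \<union> C"
    using S(1) unfolding A_def C_def by blast
  ultimately obtain Z where Z: "downset Q le Z" "A \<inter> C \<union> S \<subseteq> Z" "Z \<subseteq> A \<union> C" "card Z = n"
    using downset_interpolate[OF po dL downset_Un[OF dA dC]] finA finC by (metis finite_UnI)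
  have "nd Z"
    unfolding ndownset_def using Z finA finC finite_subset by (metis finite_UnI)
  moreover have "Z \<noteq> A" "Z \<noteq> C"
    using Z(2) p q unfolding A_def C_def by auto
  ultimately have "inter Z"
    unfolding intermediate_def A_def[symmetric] C_def[symmetric] using Z(2,3) by blast
  then show ?thesis
    using Z(2) by blast
qed

lemma intermediate_shape_is_B:
  assumes m3: "3 \<le> card (hd vs - last vs)" and Z: "inter Z"
  shows "sh Z = (SB, rB)"
proof -
  obtain W where W: "inter W" "sh W = (SB, rB)"
    using ex_intermediate_shape_B[OF m3] by blast
  obtain pW qW where pW: "pW \<in> W" "pW \<notin> last vs" "minimal_over Q le (hd vs \<inter> last vs) pW"
    and qW: "qW \<in> W" "qW \<notin> hd vs" "minimal_over Q le (hd vs \<inter> last vs) qW"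
    using intermediate_anchors[OF W(1)] .
  obtain pZ qZ where pZ: "pZ \<in> Z" "pZ \<notin> last vs" "minimal_over Q le (hd vs \<inter> last vs) pZ"
    and qZ: "qZ \<in> Z" "qZ \<notin> hd vs" "minimal_over Q le (hd vs \<inter> last vs) qZ"
    using intermediate_anchors[OF Z] .
  have "W \<subseteq> hd vs \<union> last vs" "Z \<subseteq> hd vs \<union> last vs"
    using W(1) Z unfolding intermediate_def by simp_all
  then have S: "{pW, qW, qZ} \<subseteq> hd vs \<union> last vs" "{pW, pZ, qZ} \<subseteq> hd vs \<union> last vs"
    using pW qW pZ qZ by auto
  have card3: "card {x, y, z} \<le> 3" for x y z :: 'a
    by (auto simp: card_insert_if)
  obtain Z1 where Z1: "inter Z1" "{pW, qW, qZ} \<subseteq> Z1"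
    using ex_intermediate_superset[OF m3 S(1) card3] pW qW qZ by auto
  obtain Z2 where Z2: "inter Z2" "{pW, pZ, qZ} \<subseteq> Z2"
    using ex_intermediate_superset[OF m3 S(2) card3] pW pZ qZ by auto
  have "sh Z1 = (SB, rB)"
    using intermediate_shape_B_transfer[OF m3 W(1) Z1(1) W(2), of pW qW] Z1(2) pW qW by auto
  then have "sh Z2 = (SB, rB)"
    using intermediate_shape_B_transfer[OF m3 Z1(1) Z2(1), of pW qZ] Z1(2) Z2(2) pW qZ by auto
  then show ?thesis
    using intermediate_shape_B_transfer[OF m3 Z2(1) Z, of pZ qZ] Z2(2) pZ qZ by auto
qed

lemma intermediate_degree_sum:
  assumes "3 \<le> card (hd vs - last vs)" "inter Z"
  shows "(\<Sum>z\<in>Z. down_degree Q le z) = strict_pairs SB rB"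
proof -
  have "nd Z" using assms(2) unfolding intermediate_def by simp
  then have "poset_iso Z le SB rB"
    using shape(2) intermediate_shape_is_B[OF assms] by fastforce
  then have "strict_pairs Z le = strict_pairs SB rB"
    by (rule strict_pairs_iso)
  moreover have "strict_pairs Z le = (\<Sum>z\<in>Z. down_degree Q le z)"
    using strict_pairs_downset[OF _ finQ] \<open>nd Z\<close> unfolding ndownset_def by simp
  ultimately show ?thesis by simp
qed

lemma antichain_with_ends_hd_Diff_last: "antichain_with_ends le (hd vs - last vs)"
proof (cases "3 \<le> card (hd vs - last vs)")
  case True
  interpret constant_degree_sum Q le "hd vs \<inter> last vs" "hd vs" "last vs" "strict_pairs SB rB"
  proof
    fix Z assume Z: "downset Q le Z" "hd vs \<inter> last vs \<subseteq> Z" "Z \<subseteq> hd vs \<union> last vs"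
      "card Z = card (hd vs)" "Z \<noteq> hd vs" "Z \<noteq> last vs"
    have "finite Z"
      using Z(3) nd_hd nd_last finite_subset unfolding ndownset_def by blast
    then have "inter Z"
      using Z nd_hd unfolding intermediate_def ndownset_def by simp
    then show "(\<Sum>z\<in>Z. down_degree Q le z) = strict_pairs SB rB"
      by (rule intermediate_degree_sum[OF True])
  qed (use po finQ nd_hd nd_last True in \<open>auto simp: ndownset_def\<close>)
  show ?thesis
    by (rule antichain_with_ends_Diff)
next
  case False
  moreover have "hd vs \<subseteq> Q" "finite (hd vs)"
    using nd_hd unfolding ndownset_def downset_def by auto
  ultimately show ?thesis
    using antichain_with_ends_card_le_2[OF po, of "hd vs - last vs"] by auto
qed

end

theorem mainTheorem17:
  fixes Q :: "'a set" and le :: "'a \<Rightarrow> 'a \<Rightarrow> bool" and n :: nat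
    and SA SB SC :: "'b set" and rA rB rC :: "'b \<Rightarrow> 'b \<Rightarrow> bool"
    and vs :: "'a set list"
  assumes posQ: "partial_order_on' Q le"
    and posA: "partial_order_on' SA rA" and finA: "finite SA" and cardA: "card SA = n"
    and posB: "partial_order_on' SB rB" and finB: "finite SB" and cardB: "card SB = n"
    and posC: "partial_order_on' SC rC" and finC: "finite SC" and cardC: "card SC = n"
    and nAB: "\<not> poset_iso SA rA SB rB" and nAC: "\<not> poset_iso SA rA SC rC"
    and nBC: "\<not> poset_iso SB rB SC rC"
    and wit: "witness Q le n {(SA, rA), (SB, rB), (SC, rC)}"
    and spec: "special_path Q le n {(SA, rA), (SB, rB), (SC, rC)} vs"
    and minimal: "\<forall>ws. special_path Q le n {(SA, rA), (SB, rB), (SC, rC)} ws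
                      \<longrightarrow> length vs \<le> length ws"
    and isoA: "poset_iso (hd vs) le SA rA"
    and isoB: "\<forall>i. 0 < i \<and> i < length vs - 1 \<longrightarrow> poset_iso (vs ! i) le SB rB"
    and isoC: "poset_iso (last vs) le SC rC"
    and Qunion: "Q = \<Union> (set vs)"
  shows "let X = hd vs \<inter> last vs in
           (antichain_with_ends le (hd vs - X) \<or> chain2_plus_point le (hd vs - X)) \<and>
           (antichain_with_ends le (last vs - X) \<or> chain2_plus_point le (last vs - X))"
proof -
  have "finite Q"
    using spec Qunion unfolding special_path_def exch_path_def ndownset_def by auto
  then interpret minimal_special_path Q le n SA SB SC rA rB rC "{(SA, rA), (SB, rB), (SC, rC)}" vs
    using posQ nAB nAC nBC wit spec minimal isoA isoB isoC by unfold_locales auto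
  interpret rev: minimal_special_path Q le n SC SB SA rC rB rA "{(SA, rA), (SB, rB), (SC, rC)}" "rev vs"
    by (rule minimal_special_path_rev)
  have "hd vs - hd vs \<inter> last vs = hd vs - last vs" "last vs - hd vs \<inter> last vs = last vs - hd vs"
    by auto
  moreover have "antichain_with_ends le (last vs - hd vs)"
    using rev.antichain_with_ends_hd_Diff_last vs_ne by (simp add: hd_rev last_rev)
  ultimately show ?thesis
    using antichain_with_ends_hd_Diff_last by (simp add: Let_def)
qed

end
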